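(* Let $G=(V,E)$ be a finite simple graph with $|V|\ge 2$. Then for every integer $d\ge 1$, \[ a_d(G)\le a_1(G), \] where $a_d$ denotes the $d$-dimensional algebraic connectivity defined in the context.
   Context: A realization of $G$ in $\mathbb{R}^d$ is $p=(p_i)_{i\in V}\in\mathbb{R}^{d|V|}$ with $p_i\in\mathbb{R}^d$. Let $m=\dim(\{p_i\}_{i\in V})$ be the dimension of the affine hull of the points $p_i$. For $ij\in E$ define the edge-direction vector $\delta_{ij}\in\mathbb{R}^d$ by: $\delta_{ij}=\frac{p_i-p_j}{\|p_i-p_j\|}$ if $p_i\ne p_j$; $\delta_{ij}=x$ if $p_i=p_j$ and $m=1$, where $x$ is a unit vector with $p_k-p_l\in\mathrm{span}\{x\}$ for all $k,l\in V$; and $\delta_{ij}=0$ otherwise. The normalized rigidity matrix $R_G(p)$ is the $|E|\times d|V|$ matrix with one row per edge $ij$, equal to $\delta_{ij}^T$ in the block of $d$ columns of vertex $i$, $-\delta_{ij}^T$ in the block of vertex $j$, and $0$ elsewhere. The stiffness matrix is $L_G(p)=R_G(p)^TR_G(p)$. Let $D=(m+1)(2d-m)/2$ and let $\lambda_{D+1}(L_G(p))$ denote the $(D+1)$-th smallest eigenvalue (counted with multiplicity) of $L_G(p)$. The $d$-dimensional algebraic connectivity of $G$ is \[ a_d(G)=\sup\{\lambda_{D+1}(L_G(p)) : p\in\mathbb{R}^{d|V|}\}, \] where $D$ depends on $p$ through $m$. (For $d=1$, $a_1(G)$ equals the second smallest eigenvalue of the graph Laplacian $\mathcal{L}_G$.)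 *)

theory Defs
  imports
    "HOL-Analysis.Analysis"
    "HOL-Computational_Algebra.Polynomial"
begin

text \<open>
  A graph has the elements of a finite type as its vertices and is given by its set of edges,
  each edge being an unordered pair of distinct vertices.
\<close>

definition simple_graph :: "'v::finite set set \<Rightarrow> bool" where
  "simple_graph E \<longleftrightarrow> (\<forall>e\<in>E. card e = 2)"


subsection \<open>Eigenvalues in increasing order\<close>

definition charpoly :: "real^'n^'n \<Rightarrow> real poly" where
  "charpoly A = det (mat [:0, 1:] - (\<chi> i j. [:A $ i $ j:]))"

text \<open>
  The \<open>k\<close>-th smallest real eigenvalue, counted from \<open>k = 1\<close> and with multiplicity. For a
  symmetric matrix all complex eigenvalues are real and their algebraic and geometric
  multiplicities agree, so the list has one entry per row of the matrix.
\<close>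

definition kth_eigenvalue :: "nat \<Rightarrow> real^'n^'n \<Rightarrow> real" where
  "kth_eigenvalue k A = sorted_list_of_multiset (proots (charpoly A)) ! (k - 1)"


subsection \<open>The stiffness matrix of a realization\<close>

text \<open>A realization is an arbitrary map from the vertices to Euclidean space.\<close>

definition realization_dim :: "('v::finite \<Rightarrow> real^'d) \<Rightarrow> nat" where
  "realization_dim p = nat (aff_dim (range p))"

text \<open>
  If the affine hull is a line, its unit direction is determined up to sign; the choice of
  sign (like the choice of orientation in \<open>edge_ends\<close> below) at most negates rows of the
  rigidity matrix, which does not affect the stiffness matrix.
\<close>

definition line_direction :: "('v::finite \<Rightarrow> real^'d) \<Rightarrow> real^'d" where
  "line_direction p = (SOME x. norm x = 1 \<and> (\<forall>k l. p k - p l \<in> span {x}))"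

definition edge_direction :: "('v::finite \<Rightarrow> real^'d) \<Rightarrow> 'v \<Rightarrow> 'v \<Rightarrow> real^'d" where
  "edge_direction p i j =
    (if p i \<noteq> p j then (p i - p j) /\<^sub>R norm (p i - p j)
     else if realization_dim p = 1 then line_direction p
     else 0)"

definition edge_ends :: "'v set \<Rightarrow> 'v \<times> 'v" where
  "edge_ends e = (SOME ij. e = {fst ij, snd ij})"

text \<open>
  A column index \<open>(v, c)\<close> is the coordinate \<open>c\<close> in the block of the vertex \<open>v\<close>. As an index set
  has to be a type, the rows are indexed by all sets of vertices; a set that is not an edge
  contributes a zero row, so that the Gram matrix below is the same as for the matrix whose
  only rows are those of the edges.
\<close>

definition rigidity_matrix ::
  "'v::finite set set \<Rightarrow> ('v \<Rightarrow> real^'d) \<Rightarrow> real^('v \<times> 'd)^('v set)" where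
  "rigidity_matrix E p = (\<chi> e vc.
     if e \<in> E then
       (let (i, j) = edge_ends e; (v, c) = vc in
          if v = i then edge_direction p i j $ c
          else if v = j then - (edge_direction p i j $ c)
          else 0)
     else 0)"

definition stiffness_matrix ::
  "'v::finite set set \<Rightarrow> ('v \<Rightarrow> real^'d) \<Rightarrow> real^('v \<times> 'd)^('v \<times> 'd)" where
  "stiffness_matrix E p = transpose (rigidity_matrix E p) ** rigidity_matrix E p"


subsection \<open>Algebraic connectivity\<close>

text \<open>The product is always even, and \<open>m \<le> d\<close>, so neither operation truncates.\<close>

definition trivial_motions_dim :: "('v::finite \<Rightarrow> real^'d) \<Rightarrow> nat" where
  "trivial_motions_dim p =
    (let m = realization_dim p; d = CARD('d) in (m + 1) * (2 * d - m) div 2)"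

text \<open>
  The dimension \<open>d\<close> is the cardinality of the index type \<open>'d\<close>. With at least two vertices,
  \<open>trivial_motions_dim p + 1\<close> is at most the size of the stiffness matrix, and the eigenvalues
  are bounded by its trace, which is at most twice the number of edges; the supremum is then
  one of a nonempty bounded set of reals.
\<close>

definition algebraic_connectivity :: "'d::finite itself \<Rightarrow> 'v::finite set set \<Rightarrow> real" where
  "algebraic_connectivity TYPE('d) E =
    (SUP p :: 'v \<Rightarrow> real^'d.
       kth_eigenvalue (trivial_motions_dim p + 1) (stiffness_matrix E p))"

end

theory Submission
  imports Defs
begin

text \<open>
  Let \<open>f\<close> be a unit Fiedler vector, so its Laplacian energy is \<open>a = a\<^sub>1(G)\<close>. For an orthonormal
  basis \<open>e\<^sub>c\<close> of the ambient space, the stiffness energies of the velocity fields \<open>f e\<^sub>c\<close> sum to at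
  most \<open>a\<close>, because edge directions have norm at most 1. Removing the components \<open>f e\<^sub>c\<close> has along
  the infinitesimal rigid motions, which lie in the kernel of the stiffness matrix, leaves fields
  \<open>w\<^sub>c\<close> with the same energies. Translations are orthogonal to \<open>f e\<^sub>c\<close>; for the principal axes of
  the centred realization the rotations are mutually orthogonal, and Bessel's inequality shows that
  together they absorb at most \<open>d - 1\<close> of the total squared norm \<open>d\<close>. Hence the squared norms of
  the \<open>w\<^sub>c\<close> sum to at least 1, some nonzero \<open>w\<^sub>c\<close> has Rayleigh quotient at most \<open>a\<close>, and with the
  \<open>D\<close>-dimensional space of rigid motions it spans a space to which the min-max principle applies.
\<close>

subsection \<open>Spectral theorem and the min-max principle\<close>

lemma symmetric_dot_comm:
  fixes A :: "real^'n^'n"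
  assumes "transpose A = A"
  shows "x \<bullet> (A *v y) = (A *v x) \<bullet> y"
  by (metis assms dot_lmul_matrix transpose_matrix_vector)

text \<open>A maximizer of the Rayleigh quotient on the compact unit sphere of \<open>W\<close> is
  an eigenvector: its residual \<open>z\<close> lies in \<open>W\<close>, and moving along
  \<open>z\<close> would raise the quotient unless \<open>z = 0\<close>.\<close>

lemma symmetric_eigenvector_exists:
  fixes A :: "real^'n^'n"
  assumes A: "transpose A = A" and W: "subspace W" and inv: "\<And>x. x \<in> W \<Longrightarrow> A *v x \<in> W"
    and nz: "\<exists>x\<in>W. x \<noteq> 0"
  obtains x \<mu> where "x \<in> W" "norm x = 1" "A *v x = \<mu> *\<^sub>R x"
proof -
  let ?S = "W \<inter> sphere 0 1"
  have "compact ?S"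
    using W by (simp add: closed_Int_compact closed_subspace)
  moreover obtain x0 where "x0 \<in> W" "x0 \<noteq> 0" using nz by blast
  then have "x0 /\<^sub>R norm x0 \<in> ?S" using W by (auto simp: subspace_scale)
  then have "?S \<noteq> {}" by blast
  moreover have "continuous_on ?S (\<lambda>x. x \<bullet> (A *v x))"
    by (intro continuous_intros linear_continuous_on matrix_vector_mul_bounded_linear)
  ultimately obtain x where x: "x \<in> ?S" and max: "\<And>y. y \<in> ?S \<Longrightarrow> y \<bullet> (A *v y) \<le> x \<bullet> (A *v x)"
    using continuous_attains_sup[of ?S "\<lambda>x. x \<bullet> (A *v x)"] by blast
  define \<mu> where "\<mu> = x \<bullet> (A *v x)"
  have le: "y \<bullet> (A *v y) \<le> \<mu> * (y \<bullet> y)" if "y \<in> W" for y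
  proof (cases "y = 0")
    case False
    then have "y /\<^sub>R norm y \<in> ?S" using that W by (auto simp: subspace_scale)
    from max[OF this] have "(y \<bullet> (A *v y)) / (norm y)^2 \<le> \<mu>"
      by (simp add: \<mu>_def scaleR_matrix_vector_assoc [symmetric] matrix_vector_mult_scaleR divide_inverse power2_eq_square mult_ac)
    then show ?thesis using False
      by (simp add: divide_le_eq power2_norm_eq_inner)
  qed simp
  define z where "z = A *v x - \<mu> *\<^sub>R x"
  have xW: "x \<in> W" and nx: "x \<bullet> x = 1" using x by (auto simp: norm_eq_1)
  have zW: "z \<in> W" unfolding z_def using xW W inv by (simp add: subspace_diff subspace_scale)
  \<comment> \<open>Testing the maximum at \<open>x + t *\<^sub>R z\<close> leaves a term linear in
    \<open>t\<close> on the left and only a quadratic one on the right.\<close>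
  define C where "C = \<mu> * (z \<bullet> z) - z \<bullet> (A *v z)"
  have *: "2 * t * (z \<bullet> z) \<le> t^2 * C" for t
  proof -
    have "x + t *\<^sub>R z \<in> W" using xW zW W by (simp add: subspace_add subspace_scale)
    from le[OF this] have "\<mu> + 2 * t * (z \<bullet> (A *v x)) + t^2 * (z \<bullet> (A *v z))
        \<le> \<mu> * (1 + 2 * t * (z \<bullet> x) + t^2 * (z \<bullet> z))"
      by (simp add: matrix_vector_right_distrib matrix_vector_mult_scaleR inner_add_left inner_add_right
          nx \<mu>_def[symmetric] symmetric_dot_comm[OF A, of x z] inner_commute power2_eq_square algebra_simps)
    moreover have "z \<bullet> (A *v x) = z \<bullet> z + \<mu> * (z \<bullet> x)"
      by (subst (3) z_def) (simp add: inner_diff_right)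
    ultimately show ?thesis unfolding C_def
      by (simp only: distrib_left distrib_right right_diff_distrib) (simp add: mult_ac)
  qed
  have "z \<bullet> z \<le> 0"
  proof (rule ccontr)
    assume "\<not> ?thesis"
    then have pos: "z \<bullet> z > 0" by (simp only: not_le)
    \<comment> \<open>Chosen so that \<open>t * C\<close> is at most \<open>z \<bullet> z\<close>;
      adding 1 keeps the denominator positive.\<close>
    define t where "t = (z \<bullet> z) / (\<bar>C\<bar> + 1)"
    have t: "t > 0" using pos by (simp add: t_def)
    have "2 * (z \<bullet> z) \<le> t * C" using *[of t] t by (simp add: power2_eq_square)
    also have "\<dots> \<le> t * (\<bar>C\<bar> + 1)" using t by (intro mult_left_mono) auto
    also have "\<dots> = z \<bullet> z" by (simp add: t_def)
    finally show False using pos by simp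
  qed
  then have "z = 0" by (metis inner_gt_zero_iff not_le)
  then show ?thesis using that[of x \<mu>] x by (auto simp: z_def)
qed

text \<open>By symmetry the orthogonal complement of the eigenvectors found so far is invariant, and
  it is nonzero while their number is below \<open>CARD('n)\<close>; so it contains the next
  one.\<close>

lemma symmetric_orthonormal_eigenvectors:
  fixes A :: "real^'n^'n"
  assumes A: "transpose A = A" and "k \<le> CARD('n)"
  shows "\<exists>B. card B = k \<and> finite B \<and> pairwise orthogonal B \<and>
             (\<forall>b\<in>B. norm b = 1 \<and> (\<exists>\<mu>. A *v b = \<mu> *\<^sub>R b))"
  using assms(2)
proof (induction k)
  case 0
  then show ?case by (intro exI[of _ "{}"]) auto
next
  case (Suc k)
  then obtain B where B: "card B = k" "finite B" "pairwise orthogonal B"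
    "\<And>b. b \<in> B \<Longrightarrow> norm b = 1" "\<And>b. b \<in> B \<Longrightarrow> \<exists>\<mu>. A *v b = \<mu> *\<^sub>R b" by auto
  define W where "W = {x. \<forall>b\<in>B. b \<bullet> x = 0}"
  have "subspace W" unfolding W_def subspace_def by (auto simp: inner_add_right)
  moreover have "A *v x \<in> W" if "x \<in> W" for x
  proof -
    have "b \<bullet> (A *v x) = 0" if "b \<in> B" for b
    proof -
      obtain \<mu> where "A *v b = \<mu> *\<^sub>R b" using B(5) \<open>b \<in> B\<close> by blast
      then show ?thesis using \<open>x \<in> W\<close> \<open>b \<in> B\<close>
        by (simp add: symmetric_dot_comm[OF A] W_def)
    qed
    then show ?thesis by (simp add: W_def)
  qed
  moreover have "\<exists>x\<in>W. x \<noteq> 0"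
  proof -
    have "dim (span B) \<le> card B" using B(2) by (simp add: dim_le_card')
    then have "dim (span B) < DIM(real^'n)" using Suc B by simp
    then obtain x where "x \<noteq> 0" "\<And>y. y \<in> span B \<Longrightarrow> orthogonal x y"
      using orthogonal_to_subspace_exists by (metis span_span dim_span)
    then show ?thesis unfolding W_def
      by (intro bexI[of _ x]) (auto simp: span_base orthogonal_def inner_commute)
  qed
  ultimately obtain x \<mu> where x: "x \<in> W" "norm x = 1" "A *v x = \<mu> *\<^sub>R x"
    using symmetric_eigenvector_exists[OF A] by metis
  have "x \<notin> B" using x by (auto simp: W_def norm_eq_1)
  moreover have "pairwise orthogonal (insert x B)"
    using B(3) x(1) by (auto simp: pairwise_insert orthogonal_def W_def inner_commute)
  ultimately show ?case using B x by (intro exI[of _ "insert x B"]) auto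
qed

lemma symmetric_matrix_eigenbasis:
  fixes A :: "real^'n^'n"
  assumes "transpose A = A"
  obtains e :: "'n \<Rightarrow> real^'n" and \<theta> where
    "\<And>i j. e i \<bullet> e j = (if i = j then 1 else 0)" "\<And>i. A *v e i = \<theta> i *\<^sub>R e i"
proof -
  obtain B where B: "card B = CARD('n)" "finite B" "pairwise orthogonal B"
    "\<And>b. b \<in> B \<Longrightarrow> norm b = 1" "\<And>b. b \<in> B \<Longrightarrow> \<exists>\<mu>. A *v b = \<mu> *\<^sub>R b"
    using symmetric_orthonormal_eigenvectors[OF assms order_refl] by auto
  obtain e where e: "bij_betw e (UNIV::'n set) B"
    using finite_same_card_bij[of "UNIV::'n set" B] B by auto
  then have eB: "e i \<in> B" for i by (auto simp: bij_betw_def)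
  then have "\<forall>i. \<exists>\<mu>. A *v e i = \<mu> *\<^sub>R e i" using B(5) by blast
  from choice[OF this] obtain \<theta> where "\<And>i. A *v e i = \<theta> i *\<^sub>R e i" by auto
  moreover have "e i \<bullet> e j = (if i = j then 1 else 0)" for i j
  proof (cases "i = j")
    case True then show ?thesis using B(4)[OF eB] by (simp add: norm_eq_1)
  next
    case False
    then have "e i \<noteq> e j" using e by (auto simp: bij_betw_def inj_on_def)
    then show ?thesis using B(3) eB False by (auto simp: pairwise_def orthogonal_def)
  qed
  ultimately show ?thesis using that by blast
qed

section \<open>Eigenvalues counted with multiplicity\<close>

lemma poly_charpoly: "poly (charpoly A) x = det (mat x - A)"
  unfolding charpoly_def det_def poly_sum poly_mult poly_prod
  by (intro sum.cong refl arg_cong2[of _ _ _ _ "(*)"] prod.cong)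
     (auto simp: mat_def sign_def)

text \<open>The matrix \<open>P\<close> with the eigenvectors as columns is invertible and
  diagonalizes \<open>mat x - A\<close> for every real \<open>x\<close>; polynomials with equal
  values everywhere are equal.\<close>

lemma charpoly_eigenbasis:
  fixes A :: "real^'n^'n" and e :: "'n \<Rightarrow> real^'n"
  assumes e: "\<And>i j. e i \<bullet> e j = (if i = j then 1 else 0)" and l: "\<And>i. A *v e i = \<theta> i *\<^sub>R e i"
  shows "charpoly A = (\<Prod>i\<in>UNIV. [:- \<theta> i, 1:])"
proof -
  define P :: "real^'n^'n" where "P = (\<chi> i j. e j $ i)"
  have "transpose P ** P = mat 1"
    using e by (simp add: P_def matrix_matrix_mult_def transpose_def mat_def vec_eq_iff inner_vec_def)
  then have "det P \<noteq> 0" by (metis det_I det_mul det_transpose mult_zero_left zero_neq_one)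
  have "poly (charpoly A) x = (\<Prod>i\<in>UNIV. x - \<theta> i)" for x
  proof -
    define D :: "real^'n^'n" where "D = (\<chi> i j. if i = j then x - \<theta> i else 0)"
    have "(mat x - A) ** P = P ** D"
    proof -
      have "(\<Sum>k\<in>UNIV. (mat x - A) $ i $ k * e j $ k) = e j $ i * (x - \<theta> j)" for i j
      proof -
        have "(\<Sum>k\<in>UNIV. A $ i $ k * e j $ k) = \<theta> j * e j $ i"
          using l[of j] by (simp add: matrix_vector_mult_def vec_eq_iff)
        moreover have "(\<Sum>k\<in>UNIV. mat x $ i $ k * e j $ k) = x * e j $ i"
          by (simp add: mat_def if_distrib[of "\<lambda>u. u * _"] cong: if_cong)
        ultimately show ?thesis by (simp add: left_diff_distrib sum_subtractf algebra_simps)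
      qed
      then show ?thesis
        by (simp add: P_def D_def matrix_matrix_mult_def vec_eq_iff if_distrib[of "\<lambda>u. _ * u"] cong: if_cong)
    qed
    then have "det (mat x - A) * det P = det P * det D" by (metis det_mul)
    then have "det (mat x - A) = det D" using \<open>det P \<noteq> 0\<close> by simp
    also have "\<dots> = (\<Prod>i\<in>UNIV. x - \<theta> i)"
      by (subst det_diagonal) (auto simp: D_def)
    finally show ?thesis by (simp add: poly_charpoly)
  qed
  then have "poly (charpoly A) = poly (\<Prod>i\<in>UNIV. [:- \<theta> i, 1:])"
    by (auto simp: poly_prod)
  then show ?thesis by (simp only: poly_eq_poly_eq_iff)
qed

lemma proots_charpoly_eigenbasis:
  fixes A :: "real^'n^'n" and e :: "'n \<Rightarrow> real^'n"
  assumes e: "\<And>i j. e i \<bullet> e j = (if i = j then 1 else 0)" and l: "\<And>i. A *v e i = \<theta> i *\<^sub>R e i"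
  shows "proots (charpoly A) = image_mset \<theta> (mset_set UNIV)"
proof -
  have "proots (\<Prod>i\<in>I. [:- \<theta> i, 1:]) = image_mset \<theta> (mset_set I)" if "finite I" for I :: "'n set"
    using that
  proof induction
    case (insert i I)
    have "(\<Prod>i\<in>I. [:- \<theta> i, 1:]) \<noteq> 0" by (simp add: insert.hyps)
    then show ?case using insert by (simp add: proots_mult del: mult_pCons_left)
  qed auto
  then show ?thesis using charpoly_eigenbasis[OF assms] by simp
qed

text \<open>All positions up to \<open>k\<close>, respectively from \<open>k\<close> on, qualify;
  ties can only add more. Positions start at 0, hence \<open>Suc k\<close>.\<close>

lemma sorted_nth_card_filter:
  assumes "sorted xs" "k < length xs"
  shows "Suc k \<le> length (filter (\<lambda>x. x \<le> xs ! k) xs)"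
    and "length xs - k \<le> length (filter (\<lambda>x. xs ! k \<le> x) xs)"
proof -
  have "{..k} \<subseteq> {i. i < length xs \<and> xs ! i \<le> xs ! k}"
    using assms by (auto simp: sorted_nth_mono)
  from card_mono[OF _ this] show "Suc k \<le> length (filter (\<lambda>x. x \<le> xs ! k) xs)"
    by (simp add: length_filter_conv_card)
  have "{k..<length xs} \<subseteq> {i. i < length xs \<and> xs ! k \<le> xs ! i}"
    using assms by (auto simp: sorted_nth_mono)
  from card_mono[OF _ this] show "length xs - k \<le> length (filter (\<lambda>x. xs ! k \<le> x) xs)"
    by (simp add: length_filter_conv_card)
qed

text \<open>Min-max arguments compare dimensions, so they access the \<open>k\<close>-th eigenvalue
  through these two counts. The second says at least \<open>CARD('n) - k + 1\<close>, phrased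
  without subtraction.\<close>

lemma kth_eigenvalue_card:
  fixes A :: "real^'n^'n" and e :: "'n \<Rightarrow> real^'n"
  assumes e: "\<And>i j. e i \<bullet> e j = (if i = j then 1 else 0)" and l: "\<And>i. A *v e i = \<theta> i *\<^sub>R e i"
    and k: "1 \<le> k" "k \<le> CARD('n)"
  shows "k \<le> card {i. \<theta> i \<le> kth_eigenvalue k A}"
    and "CARD('n) < card {i. kth_eigenvalue k A \<le> \<theta> i} + k"
proof -
  let ?M = "image_mset \<theta> (mset_set (UNIV::'n set))"
  define xs where "xs = sorted_list_of_multiset ?M"
  have mset: "mset xs = ?M" by (simp add: xs_def)
  have len: "length xs = CARD('n)" using arg_cong[OF mset, of size] by simp
  have kth: "kth_eigenvalue k A = xs ! (k - 1)"
    by (simp add: kth_eigenvalue_def xs_def proots_charpoly_eigenbasis[OF e l])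
  have cnt: "length (filter Q xs) = card {i. Q (\<theta> i)}" for Q
  proof -
    have "length (filter Q xs) = size (filter_mset Q (mset xs))" by (metis mset_filter size_mset)
    also have "\<dots> = card {i. Q (\<theta> i)}" by (simp add: mset filter_mset_image_mset)
    finally show ?thesis .
  qed
  have "sorted xs" by (simp add: xs_def)
  moreover have "k - 1 < length xs" using len k by simp
  ultimately have "Suc (k - 1) \<le> card {i. \<theta> i \<le> xs ! (k - 1)}"
    and "CARD('n) - (k - 1) \<le> card {i. xs ! (k - 1) \<le> \<theta> i}"
    using sorted_nth_card_filter[of xs "k - 1"] unfolding cnt len by blast+
  then show "k \<le> card {i. \<theta> i \<le> kth_eigenvalue k A}"
    and "CARD('n) < card {i. kth_eigenvalue k A \<le> \<theta> i} + k"
    unfolding kth using k by linarith+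
qed

text \<open>In eigencoordinates the Rayleigh quotient is a weighted mean of the eigenvalues
  involved, so their bounds carry over.\<close>

lemma eigenbasis_span:
  fixes A :: "real^'n^'n" and e :: "'n \<Rightarrow> real^'n"
  assumes e: "\<And>i j. e i \<bullet> e j = (if i = j then 1 else 0)" and l: "\<And>i. A *v e i = \<theta> i *\<^sub>R e i"
  shows "dim (span (e ` I)) = card I"
    and "x \<in> span (e ` I) \<Longrightarrow> (\<And>i. i \<in> I \<Longrightarrow> \<theta> i \<le> c) \<Longrightarrow> x \<bullet> (A *v x) \<le> c * (x \<bullet> x)"
    and "x \<in> span (e ` I) \<Longrightarrow> (\<And>i. i \<in> I \<Longrightarrow> c \<le> \<theta> i) \<Longrightarrow> c * (x \<bullet> x) \<le> x \<bullet> (A *v x)"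
proof -
  have inj: "inj e"
    by (rule injI) (metis e zero_neq_one)
  have "independent (e ` I)"
  proof (rule pairwise_orthogonal_independent)
    show "pairwise orthogonal (e ` I)" by (auto simp: pairwise_def orthogonal_def e)
    show "0 \<notin> e ` I" by (metis e image_iff inner_zero_left zero_neq_one)
  qed
  then show "dim (span (e ` I)) = card I"
    by (simp add: dim_eq_card_independent card_image inj_on_subset[OF inj])
  have rep: "\<exists>a. x \<bullet> x = (\<Sum>i\<in>I. (a i)^2) \<and> x \<bullet> (A *v x) = (\<Sum>i\<in>I. \<theta> i * (a i)^2)"
    if "x \<in> span (e ` I)" for x
  proof -
    from that obtain b where "x = (\<Sum>v\<in>e ` I. b v *\<^sub>R v)"
      using span_finite[of "e ` I"] by auto
    then have x: "x = (\<Sum>i\<in>I. b (e i) *\<^sub>R e i)"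
      by (simp add: sum.reindex inj_on_subset[OF inj])
    have Ax: "A *v x = (\<Sum>i\<in>I. (b (e i) * \<theta> i) *\<^sub>R e i)"
      by (simp add: x matrix_vector_mult_scaleR l linear_sum[OF matrix_vector_mul_linear])
    have dot: "x \<bullet> (\<Sum>i\<in>I. d i *\<^sub>R e i) = (\<Sum>i\<in>I. b (e i) * d i)" for d
      by (simp add: x inner_sum_left inner_sum_right e if_distrib[of "\<lambda>u. _ * u"] mult.commute cong: if_cong)
    have "x \<bullet> x = (\<Sum>i\<in>I. (b (e i))^2)"
      by (subst (2) x) (simp add: dot power2_eq_square)
    moreover have "x \<bullet> (A *v x) = (\<Sum>i\<in>I. \<theta> i * (b (e i))^2)"
      by (simp add: Ax dot power2_eq_square mult_ac)
    ultimately show ?thesis by (intro exI[of _ "\<lambda>i. b (e i)"] conjI)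
  qed
  show "x \<bullet> (A *v x) \<le> c * (x \<bullet> x)"
    if "x \<in> span (e ` I)" "\<And>i. i \<in> I \<Longrightarrow> \<theta> i \<le> c"
    using rep[OF that(1)] that(2) by (auto simp: sum_distrib_left intro!: sum_mono mult_right_mono)
  show "c * (x \<bullet> x) \<le> x \<bullet> (A *v x)"
    if "x \<in> span (e ` I)" "\<And>i. i \<in> I \<Longrightarrow> c \<le> \<theta> i"
    using rep[OF that(1)] that(2) by (auto simp: sum_distrib_left intro!: sum_mono mult_right_mono)
qed

section \<open>The min-max principle\<close>

lemma subspaces_intersect:
  fixes S T :: "'a::euclidean_space set"
  assumes "subspace S" "subspace T" "DIM('a) < dim S + dim T"
  obtains x where "x \<in> S" "x \<in> T" "x \<noteq> 0"
proof -
  have "dim {x + y |x y. x \<in> S \<and> y \<in> T} + dim (S \<inter> T) = dim S + dim T"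
    using assms dim_sums_Int by blast
  moreover have "dim {x + y |x y. x \<in> S \<and> y \<in> T} \<le> DIM('a)" by (rule dim_subset_UNIV)
  ultimately have "dim (S \<inter> T) \<noteq> 0" using assms(3) by linarith
  then have "\<not> S \<inter> T \<subseteq> {0}" by (simp add: dim_eq_0)
  then show ?thesis using that by blast
qed

text \<open>For dimension reasons \<open>S\<close> meets the span of the eigenvectors whose
  eigenvalue is at least the \<open>k\<close>-th; a common nonzero vector has its Rayleigh quotient
  between the two bounds.\<close>

lemma kth_eigenvalue_le:
  fixes A :: "real^'n^'n"
  assumes A: "transpose A = A" and S: "subspace S" "1 \<le> k" "k \<le> dim S"
    and le: "\<And>x. x \<in> S \<Longrightarrow> x \<bullet> (A *v x) \<le> c * (x \<bullet> x)"
  shows "kth_eigenvalue k A \<le> c"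
proof -
  obtain e :: "'n \<Rightarrow> real^'n" and \<theta> where e: "\<And>i j. e i \<bullet> e j = (if i = j then 1 else 0)"
    and l: "\<And>i. A *v e i = \<theta> i *\<^sub>R e i"
    using symmetric_matrix_eigenbasis[OF A] by blast
  let ?J = "{i. kth_eigenvalue k A \<le> \<theta> i}"
  have "dim S \<le> CARD('n)" using dim_subset_UNIV[of S] by simp
  then have "k \<le> CARD('n)" using S by simp
  then have "CARD('n) < card ?J + k" using kth_eigenvalue_card(2)[OF e l] S by blast
  then have "DIM(real^'n) < dim S + dim (span (e ` ?J))"
    using S by (simp only: eigenbasis_span(1)[OF e l]) simp
  then obtain x where x: "x \<in> S" "x \<in> span (e ` ?J)" "x \<noteq> 0"
    using subspaces_intersect[OF S(1) subspace_span] by blast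
  have "kth_eigenvalue k A * (x \<bullet> x) \<le> x \<bullet> (A *v x)"
    using eigenbasis_span(3)[OF e l x(2), of "kth_eigenvalue k A"] by blast
  also have "\<dots> \<le> c * (x \<bullet> x)" using le x by blast
  finally show ?thesis using x(3) by simp
qed

text \<open>The attaining half of min-max, from which the Fiedler function is later
  extracted.\<close>

lemma kth_eigenvalue_subspace:
  fixes A :: "real^'n^'n"
  assumes A: "transpose A = A" and k: "1 \<le> k" "k \<le> CARD('n)"
  obtains S where "subspace S" "k \<le> dim S" 
    "\<And>x. x \<in> S \<Longrightarrow> x \<bullet> (A *v x) \<le> kth_eigenvalue k A * (x \<bullet> x)"
proof -
  obtain e :: "'n \<Rightarrow> real^'n" and \<theta> where e: "\<And>i j. e i \<bullet> e j = (if i = j then 1 else 0)"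
    and l: "\<And>i. A *v e i = \<theta> i *\<^sub>R e i"
    using symmetric_matrix_eigenbasis[OF A] by blast
  let ?J = "{i. \<theta> i \<le> kth_eigenvalue k A}"
  have "k \<le> dim (span (e ` ?J))"
    using kth_eigenvalue_card(1)[OF e l k] by (simp only: eigenbasis_span(1)[OF e l])
  then show ?thesis
    using that[OF subspace_span] eigenbasis_span(2)[OF e l, where I="?J" and c="kth_eigenvalue k A"] by blast
qed

text \<open>The test space is spanned by the kernel vectors and \<open>w\<close>. A kernel component
  \<open>y\<close> adds no energy, while \<open>c * (y \<bullet> y)\<close> only enlarges the upper
  bound.\<close>

lemma kth_eigenvalue_kernel_le:
  fixes A :: "real^'n^'n"
  assumes A: "transpose A = A" and fin: "finite I"
    and orth: "\<And>i j. i \<in> I \<Longrightarrow> j \<in> I \<Longrightarrow> i \<noteq> j \<Longrightarrow> b i \<bullet> b j = 0"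
    and nz: "\<And>i. i \<in> I \<Longrightarrow> b i \<noteq> 0" and ker: "\<And>i. i \<in> I \<Longrightarrow> A *v b i = 0"
    and w: "w \<noteq> 0" "\<And>i. i \<in> I \<Longrightarrow> w \<bullet> b i = 0" "w \<bullet> (A *v w) \<le> c * (w \<bullet> w)" and "0 \<le> c"
  shows "kth_eigenvalue (card I + 1) A \<le> c"
proof (rule kth_eigenvalue_le[OF A])
  let ?B = "insert w (b ` I)"
  have inj: "inj_on b I"
    by (rule inj_onI) (metis orth nz inner_eq_zero_iff)
  have "w \<notin> b ` I" using w(1,2) by force
  then have card: "card ?B = card I + 1" using fin by (simp add: card_image inj)
  have "pairwise orthogonal ?B"
    using orth w(2) by (auto simp: pairwise_def orthogonal_def inner_commute)
  moreover have "0 \<notin> ?B" using nz w(1) by auto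
  ultimately have "independent ?B" by (rule pairwise_orthogonal_independent)
  then have "dim ?B = card ?B" by (rule dim_eq_card_independent)
  then show "card I + 1 \<le> dim (span ?B)" by (simp only: dim_span card order_refl)
  fix x assume "x \<in> span ?B"
  then obtain a where k: "x - a *\<^sub>R w \<in> span (b ` I)" using span_breakdown_eq by blast
  define y where "y = x - a *\<^sub>R w"
  have "span (b ` I) \<subseteq> {z. A *v z = 0 \<and> w \<bullet> z = 0}"
    by (rule span_minimal)
       (auto simp: ker w subspace_def matrix_vector_right_distrib matrix_vector_mult_scaleR inner_add_right)
  then have y: "A *v y = 0" "w \<bullet> y = 0" using k by (auto simp: y_def)
  have x: "x = y + a *\<^sub>R w" by (simp add: y_def)
  have "x \<bullet> (A *v x) = a^2 * (w \<bullet> (A *v w))"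
    by (simp add: x matrix_vector_right_distrib matrix_vector_mult_scaleR y inner_add_left
        symmetric_dot_comm[OF A, of y] power2_eq_square)
  also have "\<dots> \<le> a^2 * (c * (w \<bullet> w))" using w(3) by (intro mult_left_mono) auto
  also have "\<dots> \<le> c * (y \<bullet> y) + a^2 * (c * (w \<bullet> w))" using \<open>0 \<le> c\<close> by simp
  also have "\<dots> = c * (x \<bullet> x)"
    by (simp add: x inner_add_left inner_add_right y inner_commute[of y w] power2_eq_square algebra_simps)
  finally show "x \<bullet> (A *v x) \<le> c * (x \<bullet> x)" .
qed auto

text \<open>Completeness and Parseval: a left inverse of a square matrix is also a right
  inverse.\<close>

lemma orthonormal_family_expansion:
  fixes e :: "'n::finite \<Rightarrow> real^'n"
  assumes e: "\<And>i j. e i \<bullet> e j = (if i = j then 1 else 0)"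
  shows "x = (\<Sum>c\<in>UNIV. (x \<bullet> e c) *\<^sub>R e c)" and "x \<bullet> x = (\<Sum>c\<in>UNIV. (x \<bullet> e c)\<^sup>2)"
proof -
  define P :: "real^'n^'n" where "P = (\<chi> i j. e j $ i)"
  have "transpose P ** P = mat 1"
    using e by (simp add: P_def matrix_matrix_mult_def transpose_def mat_def vec_eq_iff inner_vec_def)
  then have "P ** transpose P = mat 1" using matrix_left_right_inverse by blast
  then have "x = P *v (transpose P *v x)" by (metis matrix_vector_mul_assoc matrix_vector_mul_lid)
  also have "\<dots> = (\<Sum>c\<in>UNIV. (x \<bullet> e c) *\<^sub>R e c)"
    by (simp add: vec_eq_iff P_def matrix_vector_mult_def transpose_def inner_vec_def mult_ac)
  finally show x: "x = (\<Sum>c\<in>UNIV. (x \<bullet> e c) *\<^sub>R e c)" .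
  show "x \<bullet> x = (\<Sum>c\<in>UNIV. (x \<bullet> e c)\<^sup>2)"
    by (subst (2) x) (simp add: inner_sum_right power2_eq_square)
qed

subsection \<open>Stiffness energy\<close>

text \<open>The pair index matches the columns of \<open>rigidity_matrix\<close>, so that velocity
  fields on the vertices become vectors it acts on.\<close>

definition flatten :: "('v::finite \<Rightarrow> real^'d) \<Rightarrow> real^('v \<times> 'd)" where
  "flatten q = (\<chi> vc. q (fst vc) $ snd vc)"

lemma inner_flatten: "flatten q \<bullet> flatten r = (\<Sum>v\<in>UNIV. q v \<bullet> r v)"
  by (simp add: flatten_def inner_vec_def UNIV_Times_UNIV[symmetric] sum.cartesian_product case_prod_unfold
      del: UNIV_Times_UNIV)

lemma flatten_eq_0_iff: "flatten q = 0 \<longleftrightarrow> q = (\<lambda>v. 0)"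
  by (auto simp: flatten_def vec_eq_iff fun_eq_iff)

lemma edge_ends:
  assumes "simple_graph E" "e \<in> E"
  shows "fst (edge_ends e) \<noteq> snd (edge_ends e)"
proof -
  have e: "card e = 2" using assms by (auto simp: simple_graph_def)
  then have "\<exists>ij. e = {fst ij, snd ij}" by (auto simp: card_2_iff)
  then have "e = {fst (edge_ends e), snd (edge_ends e)}" unfolding edge_ends_def by (rule someI_ex)
  then show ?thesis using e by (metis card_1_singleton_iff insert_absorb2 One_nat_def numeral_eq_one_iff semiring_norm(85))
qed

text \<open>For distinct end points this is the rate at which the edge length changes when the
  points \<open>p\<close> move with velocities \<open>q\<close>.\<close>

definition elongation :: "('v::finite \<Rightarrow> real^'d) \<Rightarrow> ('v \<Rightarrow> real^'d) \<Rightarrow> 'v set \<Rightarrow> real" where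
  "elongation p q e = (case edge_ends e of (i, j) \<Rightarrow> edge_direction p i j \<bullet> (q i - q j))"

lemma rigidity_matrix_flatten:
  assumes "simple_graph E"
  shows "rigidity_matrix E p *v flatten q = (\<chi> e. if e \<in> E then elongation p q e else 0)"
proof -
  have "(\<Sum>vc\<in>UNIV. rigidity_matrix E p $ e $ vc * flatten q $ vc) = elongation p q e" if "e \<in> E" for e
  proof -
    obtain i j where ij: "edge_ends e = (i, j)" by fastforce
    then have "i \<noteq> j" using edge_ends[OF assms that] by simp
    have "(\<Sum>vc\<in>UNIV. rigidity_matrix E p $ e $ vc * flatten q $ vc) =
      (\<Sum>v\<in>UNIV. \<Sum>c\<in>UNIV. rigidity_matrix E p $ e $ (v, c) * flatten q $ (v, c))"
      by (simp add: sum.cartesian_product)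
    \<comment> \<open>Since the ends differ, the nested conditional of a row splits into a sum of
      two indicators.\<close>
    also have "\<dots> = (\<Sum>v\<in>UNIV. (if v = i then edge_direction p i j \<bullet> q v else 0)
                   + (if v = j then - (edge_direction p i j \<bullet> q v) else 0))"
      using that \<open>i \<noteq> j\<close>
      by (intro sum.cong refl) (auto simp: rigidity_matrix_def flatten_def ij inner_vec_def sum_negf)
    also have "\<dots> = elongation p q e"
      by (simp add: sum.distrib elongation_def ij inner_diff_right)
    finally show ?thesis .
  qed
  then show ?thesis
    by (auto simp: vec_eq_iff matrix_vector_mult_def rigidity_matrix_def)
qed

lemma transpose_stiffness_matrix: "transpose (stiffness_matrix E p) = stiffness_matrix E p"
  by (simp add: stiffness_matrix_def matrix_transpose_mul)

lemma stiffness_matrix_energy: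
  assumes "simple_graph E"
  shows "flatten q \<bullet> (stiffness_matrix E p *v flatten q) = (\<Sum>e\<in>E. (elongation p q e)\<^sup>2)"
proof -
  let ?R = "rigidity_matrix E p"
  have "flatten q \<bullet> (stiffness_matrix E p *v flatten q) = (?R *v flatten q) \<bullet> (?R *v flatten q)"
    by (simp add: stiffness_matrix_def matrix_vector_mul_assoc[symmetric] dot_lmul_matrix[symmetric] inner_commute)
  also have "\<dots> = (\<Sum>e\<in>UNIV. if e \<in> E then (elongation p q e)\<^sup>2 else 0)"
    unfolding rigidity_matrix_flatten[OF assms] inner_vec_def
    by (intro sum.cong) (auto simp: power2_eq_square)
  also have "\<dots> = (\<Sum>e\<in>E. (elongation p q e)\<^sup>2)"
    by (simp add: sum.If_cases)
  finally show ?thesis .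
qed

lemma stiffness_matrix_kernel:
  assumes "simple_graph E" "\<And>e. elongation p q e = 0"
  shows "stiffness_matrix E p *v flatten q = 0"
proof -
  have "rigidity_matrix E p *v flatten q = 0"
    by (simp add: rigidity_matrix_flatten[OF assms(1)] assms(2) vec_eq_iff)
  then show ?thesis
    by (simp add: stiffness_matrix_def matrix_vector_mul_assoc[symmetric] del: transpose_matrix_vector)
qed

section \<open>Edge directions and infinitesimal rotations\<close>

text \<open>\<open>line_direction\<close> is a choice, so a witness is required: the differences
  span a line, and a basis vector of it is normalized.\<close>

lemma norm_line_direction:
  assumes "realization_dim p = 1"
  shows "norm (line_direction p) = 1"
proof -
  fix a
  let ?D = "(\<lambda>x. x - p a) ` range p"
  have "aff_dim (range p) = int (dim ?D)"
    by (intro aff_dim_eq_dim_subtract hull_inc) auto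
  then have "dim ?D = 1" using assms by (simp add: realization_dim_def)
  then obtain B where B: "B \<subseteq> ?D" "independent B" "?D \<subseteq> span B" "card B = 1"
    using basis_exists by metis
  then obtain b where b: "B = {b}" by (auto simp: card_1_singleton_iff)
  have "b \<noteq> 0" using B(2) dependent_zero b by auto
  define x where "x = b /\<^sub>R norm b"
  have "norm x = 1" using \<open>b \<noteq> 0\<close> by (simp add: x_def)
  moreover have "p k - p l \<in> span {x}" for k l
  proof -
    have "b = norm b *\<^sub>R x" using \<open>b \<noteq> 0\<close> by (simp add: x_def)
    then have "b \<in> span {x}" by (metis span_base span_scale singletonI)
    then have "span B \<subseteq> span {x}" unfolding b by (intro span_minimal) auto
    then have "p k - p a \<in> span {x}" "p l - p a \<in> span {x}" using B(3) by blast+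
    from span_diff[OF this] show ?thesis by simp
  qed
  ultimately have "\<exists>x. norm x = 1 \<and> (\<forall>k l. p k - p l \<in> span {x})" by blast
  from someI_ex[OF this] show ?thesis unfolding line_direction_def by blast
qed

lemma norm_edge_direction_le: "norm (edge_direction p i j) \<le> 1"
  by (simp add: edge_direction_def norm_line_direction)

text \<open>For distinct end points the direction is parallel to \<open>p i - p j\<close> and a
  rotation acts skew-symmetrically. For coinciding ones the second factor vanishes, whatever the
  direction is.\<close>

lemma edge_direction_rotation:
  "edge_direction p i j \<bullet> (((p i - p j) \<bullet> x) *\<^sub>R y - ((p i - p j) \<bullet> y) *\<^sub>R x) = 0"
  by (simp add: edge_direction_def inner_diff_right inner_diff_left algebra_simps)

section \<open>Bessel's inequality and dimension counts\<close>

text \<open>\<open>h\<close> is the orthogonal projection of \<open>f\<close> to the span of the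
  \<open>y b\<close>, and \<open>f - h\<close> has nonnegative squared norm. If
  \<open>s b = 0\<close>, then \<open>y b\<close> vanishes and the division by zero yields the right
  value 0.\<close>

lemma bessel_sum:
  fixes y :: "'d::finite \<Rightarrow> 'v::finite \<Rightarrow> real"
  assumes y: "\<And>a b. (\<Sum>v\<in>UNIV. y a v * y b v) = (if a = b then s a else 0)"
  shows "(\<Sum>b\<in>UNIV. (\<Sum>v\<in>UNIV. f v * y b v)\<^sup>2 / s b) \<le> (\<Sum>v\<in>UNIV. (f v)\<^sup>2)"
proof -
  define g where "g b = (\<Sum>v\<in>UNIV. f v * y b v)" for b
  define h where "h v = (\<Sum>b\<in>UNIV. g b / s b * y b v)" for v
  have fh: "(\<Sum>v\<in>UNIV. f v * h v) = (\<Sum>b\<in>UNIV. (g b)\<^sup>2 / s b)"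
  proof -
    have "(\<Sum>v\<in>UNIV. f v * h v) = (\<Sum>v\<in>UNIV. \<Sum>b\<in>UNIV. g b / s b * (f v * y b v))"
      by (simp add: h_def sum_distrib_left mult_ac)
    also have "\<dots> = (\<Sum>b\<in>UNIV. g b / s b * g b)"
      by (subst sum.swap) (simp add: g_def sum_distrib_left)
    finally show ?thesis by (simp add: power2_eq_square)
  qed
  have hh: "(\<Sum>v\<in>UNIV. h v * h v) = (\<Sum>b\<in>UNIV. (g b)\<^sup>2 / s b)"
  proof -
    \<comment> \<open>The uncancelled product also covers \<open>s b = 0\<close>.\<close>
    have hy: "(\<Sum>v\<in>UNIV. h v * y b v) = g b / s b * s b" for b
    proof -
      have "(\<Sum>v\<in>UNIV. h v * y b v) = (\<Sum>v\<in>UNIV. \<Sum>a\<in>UNIV. g a / s a * (y a v * y b v))"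
        by (simp add: h_def sum_distrib_right mult.assoc)
      also have "\<dots> = (\<Sum>a\<in>UNIV. g a / s a * (\<Sum>v\<in>UNIV. y a v * y b v))"
        by (subst sum.swap) (simp add: sum_distrib_left)
      also have "\<dots> = g b / s b * s b"
        by (simp add: y if_distrib[of "\<lambda>u. _ * u"] cong: if_cong)
      finally show ?thesis .
    qed
    have "(\<Sum>v\<in>UNIV. h v * h v) = (\<Sum>v\<in>UNIV. \<Sum>b\<in>UNIV. g b / s b * (h v * y b v))"
      by (subst (2) h_def) (simp add: sum_distrib_left mult_ac)
    also have "\<dots> = (\<Sum>b\<in>UNIV. g b / s b * (\<Sum>v\<in>UNIV. h v * y b v))"
      by (subst sum.swap) (simp add: sum_distrib_left)
    also have "\<dots> = (\<Sum>b\<in>UNIV. (g b)\<^sup>2 / s b)"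
      by (intro sum.cong) (auto simp: hy power2_eq_square)
    finally show ?thesis .
  qed
  have "0 \<le> (\<Sum>v\<in>UNIV. (f v - h v)\<^sup>2)" by (simp add: sum_nonneg)
  also have "\<dots> = (\<Sum>v\<in>UNIV. (f v)\<^sup>2) - 2 * (\<Sum>v\<in>UNIV. f v * h v) + (\<Sum>v\<in>UNIV. h v * h v)"
    by (simp add: power2_eq_square algebra_simps sum.distrib sum_subtractf sum_distrib_left)
  finally show ?thesis unfolding fh hh g_def by simp
qed

text \<open>
  The translations are indexed by the diagonal, the rotations by the pairs that meet the set \<open>M\<close> of
  principal axes along which the realization extends.
\<close>

lemma card_trivial_motions:
  fixes h :: "'d::finite \<Rightarrow> nat"
  assumes "inj h"
  shows "2 * card {(a, b). h a \<le> h b \<and> (a = b \<or> a \<in> M \<or> b \<in> M)} = (card M + 1) * (2 * CARD('d) - card M)"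
proof -
  let ?I = "{(a, b). h a \<le> h b \<and> (a = b \<or> a \<in> M \<or> b \<in> M)}"
  let ?J = "{(a, b). a = b \<or> a \<in> M \<or> b \<in> M}"
  let ?Z = "- M"
  \<comment> \<open>\<open>h\<close> serves as a linear order on the axes: \<open>?I\<close> and its
    mirror image cover \<open>?J\<close> and share exactly the diagonal.\<close>
  have "?I \<union> prod.swap ` ?I = ?J" by (auto simp: image_iff)
  moreover have int: "?I \<inter> prod.swap ` ?I = Id" using assms by (auto simp: inj_def)
  moreover have "card (Id :: ('d \<times> 'd) set) = CARD('d)"
  proof -
    have "(Id :: ('d \<times> 'd) set) = (\<lambda>a. (a, a)) ` UNIV" by auto
    moreover have "card (range (\<lambda>a::'d. (a, a))) = CARD('d)"
      by (rule card_image) (simp add: inj_on_def)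
    ultimately show ?thesis by (simp only:)
  qed
  moreover have "card (prod.swap ` ?I) = card ?I" by (simp add: card_image inj_on_def)
  ultimately have 1: "2 * card ?I = card ?J + CARD('d)"
    using card_Un_Int[of ?I "prod.swap ` ?I"] by simp
  \<comment> \<open>What \<open>?J\<close> misses is \<open>?Z \<times> ?Z\<close> without its
    diagonal.\<close>
  have "?J \<union> ?Z \<times> ?Z = UNIV" "?J \<inter> ?Z \<times> ?Z = (\<lambda>a. (a, a)) ` ?Z" by auto
  moreover have "card ((\<lambda>a. (a, a)) ` ?Z) = card ?Z" by (simp add: card_image inj_on_def)
  ultimately have 2: "card ?J + card ?Z * card ?Z = CARD('d) * CARD('d) + card ?Z"
    using card_Un_Int[of ?J "?Z \<times> ?Z"] by simp
  have d: "CARD('d) = card M + card ?Z"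
    by (metis Compl_partition Compl_disjoint card_Un_disjoint finite)
  have "2 * card ?I + card ?Z * card ?Z = (card M + 1) * (card M + 2 * card ?Z) + card ?Z * card ?Z"
    using 1 2 unfolding d by (simp add: algebra_simps)
  then show ?thesis using d by simp
qed

text \<open>The centroid 0 lies in the affine hull of the centred points, which is therefore a
  linear subspace; translation preserves affine dimension.\<close>

lemma centered_realization_dim:
  fixes p q :: "'v::finite \<Rightarrow> real^'d"
  assumes q: "\<And>v. q v = p v - a" and sum: "(\<Sum>v\<in>UNIV. q v) = 0"
  shows "realization_dim p = dim (range q)"
proof -
  have "(\<Sum>v\<in>UNIV. (1 / real CARD('v)) *\<^sub>R q v) \<in> convex hull (range q)"
    by (intro convex_sum) (auto intro: hull_inc)
  then have "0 \<in> convex hull (range q)"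
    by (simp add: scaleR_sum_right[symmetric] sum)
  then have "0 \<in> affine hull (range q)" using convex_hull_subset_affine_hull by blast
  moreover have "range q = (\<lambda>x. x - a) ` range p" using q by (auto simp: image_iff)
  ultimately show ?thesis
    by (metis aff_dim_translation_eq_subtract aff_dim_zero nat_int realization_dim_def)
qed

subsection \<open>Splitting off the rigid motions\<close>

text \<open>The bound \<alpha> is the same for all realizations in all dimensions. This uniformity
  later yields both the estimate for the supremum and the boundedness in dimension one.\<close>

lemma kth_eigenvalue_stiffness_le:
  fixes p :: "'v::finite \<Rightarrow> real^'d" and f :: "'v \<Rightarrow> real"
  assumes E: "simple_graph E" and f0: "(\<Sum>v\<in>UNIV. f v) = 0" and f1: "(\<Sum>v\<in>UNIV. (f v)\<^sup>2) = 1"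
    and energy: "(\<Sum>e\<in>E. (f (fst (edge_ends e)) - f (snd (edge_ends e)))\<^sup>2) \<le> \<alpha>"
  shows "kth_eigenvalue (trivial_motions_dim p + 1) (stiffness_matrix E p) \<le> \<alpha>"
proof -
  define a where "a = (1 / real CARD('v)) *\<^sub>R (\<Sum>v\<in>UNIV. p v)"
  define q where "q v = p v - a" for v
  have q0: "(\<Sum>v\<in>UNIV. q v) = 0" by (simp add: q_def sum_subtractf a_def sum_constant_scaleR del: sum_constant)
  \<comment> \<open>The second moment matrix of the centred points: its eigenvectors are the
    principal axes, its eigenvalues the moments along them.\<close>
  define M :: "real^'d^'d" where "M = (\<chi> i j. \<Sum>v\<in>UNIV. q v $ i * q v $ j)"
  have M: "M *v x = (\<Sum>v\<in>UNIV. (q v \<bullet> x) *\<^sub>R q v)" for x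
  proof -
    have "(M *v x) $ i = (\<Sum>v\<in>UNIV. (q v \<bullet> x) *\<^sub>R q v) $ i" for i
      unfolding M_def matrix_vector_mult_def inner_vec_def
      by (simp add: sum_distrib_right, subst sum.swap, simp add: mult_ac)
    then show ?thesis by (simp add: vec_eq_iff)
  qed
  have M_sym: "transpose M = M" by (simp add: M_def transpose_def mult.commute)
  obtain e :: "'d \<Rightarrow> real^'d" and s where
    e: "\<And>i j. e i \<bullet> e j = (if i = j then 1 else 0)" and s: "\<And>i. M *v e i = s i *\<^sub>R e i"
    using symmetric_matrix_eigenbasis[OF M_sym] by blast
  \<comment> \<open>Along principal axes the coordinates are mutually orthogonal as functions on the
    vertices, which diagonalizes the Gram matrix of the rotations.\<close>
  define y where "y b v = q v \<bullet> e b" for b v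
  have yy: "(\<Sum>v\<in>UNIV. y a v * y b v) = (if a = b then s a else 0)" for a b
  proof -
    have "(\<Sum>v\<in>UNIV. y a v * y b v) = e a \<bullet> (M *v e b)"
      by (simp add: M y_def inner_sum_right inner_commute mult_ac)
    then show ?thesis by (simp add: s e)
  qed
  have y0: "(\<Sum>v\<in>UNIV. y b v) = 0" for b
    by (simp add: y_def inner_sum_left[symmetric] q0)
  have s_nonneg: "0 \<le> s b" for b using yy[of b b] by (metis sum_nonneg zero_le_square)
  have s_0: "y b v = 0" if "s b = 0" for b v
  proof -
    have "(\<Sum>v\<in>UNIV. (y b v)\<^sup>2) = 0" using yy[of b b] that by (simp add: power2_eq_square)
    then show ?thesis by (simp add: sum_nonneg_eq_0_iff)
  qed
  define P where "P = {b. s b \<noteq> 0}"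
  have dim: "realization_dim p = card P"
  proof -
    have "span (range q) = span (e ` P)"
    proof (intro antisym span_minimal subspace_span subsetI)
      fix x assume "x \<in> range q"
      then obtain v where "x = q v" by blast
      then have "x = (\<Sum>b\<in>UNIV. y b v *\<^sub>R e b)"
        using orthonormal_family_expansion(1)[OF e, of "q v"] by (simp add: y_def)
      moreover have "y b v *\<^sub>R e b \<in> span (e ` P)" for b
        using s_0[of b v] by (cases "b \<in> P") (auto simp: P_def intro: span_base span_scale span_zero)
      ultimately show "x \<in> span (e ` P)" by (simp add: span_sum)
    next
      fix x assume "x \<in> e ` P"
      then obtain b where b: "x = e b" "s b \<noteq> 0" by (auto simp: P_def)
      have "M *v e b \<in> span (range q)" unfolding M by (intro span_sum span_scale span_base) auto
      then have "(1 / s b) *\<^sub>R (s b *\<^sub>R e b) \<in> span (range q)" unfolding s by (rule span_scale)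
      then show "x \<in> span (range q)" using b by simp
    qed
    then have "dim (range q) = dim (span (e ` P))" by (metis dim_span)
    also have "\<dots> = card P" by (rule eigenbasis_span(1)[OF e s])
    finally show ?thesis using centered_realization_dim[of q p a] q_def q0 by simp
  qed
  define g where "g b = (\<Sum>v\<in>UNIV. f v * y b v)" for b
  have g0: "g b = 0" if "s b = 0" for b by (simp add: g_def s_0[OF that])

  text \<open>
    \<open>t\<close> are the translations, \<open>r\<close> the rotations, and \<open>w c\<close> is the projection of \<open>u c\<close> to their
    orthogonal complement. If \<open>s b + s c = 0\<close>, then \<open>r c b\<close> vanishes and \<open>k c b = 0\<close>.
  \<close>
  define t :: "'d \<Rightarrow> 'v \<Rightarrow> real^'d" where "t c v = e c" for c v
  define r where "r a b v = y b v *\<^sub>R e a - y a v *\<^sub>R e b" for a b v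
  define u where "u c v = f v *\<^sub>R e c" for c v
  define k where "k c b = g b / (s b + s c)" for c b
  define w where "w c v = u c v - (\<Sum>b\<in>UNIV. k c b *\<^sub>R r c b v)" for c v

  \<comment> \<open>Since \<open>f\<close> and the coordinates have mean zero, translations are
    orthogonal to everything else. Rotations \<open>r a b\<close> and \<open>r b a\<close> are
    opposite; all other distinct index pairs give orthogonal rotations.\<close>
  have tt: "flatten (t a) \<bullet> flatten (t b) = (if a = b then real CARD('v) else 0)" for a b
    by (simp add: inner_flatten t_def e)
  have tr: "flatten (t c) \<bullet> flatten (r a b) = 0" for a b c
    by (simp add: inner_flatten t_def r_def e inner_diff_right sum_subtractf y0)
  have tu: "flatten (t a) \<bullet> flatten (u c) = 0" for a c
    by (simp add: inner_flatten t_def u_def e f0)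
  have ut: "flatten (u c) \<bullet> flatten (t a) = 0" and rt: "flatten (r a b) \<bullet> flatten (t c) = 0" for a b c
    by (metis tu inner_commute, metis tr inner_commute)
  have uu: "flatten (u c) \<bullet> flatten (u c) = 1" for c
    using f1 by (simp add: inner_flatten u_def e power2_eq_square)
  have ur: "flatten (u c) \<bullet> flatten (r a b) = (if c = a then g b else 0) - (if c = b then g a else 0)" for a b c
    by (simp add: inner_flatten u_def r_def e inner_diff_right sum_subtractf g_def right_diff_distrib mult.commute)
  have ru: "flatten (r a b) \<bullet> flatten (u c) = (if c = a then g b else 0) - (if c = b then g a else 0)" for a b c
    by (metis ur inner_commute)
  have rr: "flatten (r a b) \<bullet> flatten (r a' b') =
      (s a + s b) * ((if a = a' \<and> b = b' then 1 else 0) - (if a = b' \<and> b = a' then 1 else 0))" for a b a' b'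
  proof -
    have "flatten (r a b) \<bullet> flatten (r a' b') =
        (\<Sum>v\<in>UNIV. y b v * y b' v) * (e a \<bullet> e a') - (\<Sum>v\<in>UNIV. y b v * y a' v) * (e a \<bullet> e b')
      - (\<Sum>v\<in>UNIV. y a v * y b' v) * (e b \<bullet> e a') + (\<Sum>v\<in>UNIV. y a v * y a' v) * (e b \<bullet> e b')"
      unfolding inner_flatten r_def sum_distrib_right sum_subtractf[symmetric] sum.distrib[symmetric]
      by (intro sum.cong refl) (simp add: inner_diff_right inner_diff_left algebra_simps)
    then show ?thesis unfolding yy e
      by (cases "a = a'"; cases "b = b'"; cases "a = b'"; cases "b = a'"; simp)
  qed
  have flat_w: "flatten (w c) = flatten (u c) - (\<Sum>b\<in>UNIV. k c b *\<^sub>R flatten (r c b))" for c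
    by (simp add: flatten_def w_def vec_eq_iff)
  have wt: "flatten (w c) \<bullet> flatten (t a) = 0" for a c
    by (simp add: flat_w inner_diff_left inner_sum_left ut rt)
  have kg: "k c b * (s b + s c) = g b" for b c
    using g0[of b] s_nonneg[of b] s_nonneg[of c] by (simp add: k_def add_nonneg_eq_0_iff)
  have wr: "flatten (w c) \<bullet> flatten (r a b) = 0" for a b c
  proof -
    have "(\<Sum>b'\<in>UNIV. k c b' * (flatten (r c b') \<bullet> flatten (r a b)))
      = (\<Sum>b'\<in>UNIV. (if b' = b then (if c = a then k c b * (s b + s c) else 0) else 0)
           - (if b' = a then (if c = b then k c a * (s a + s c) else 0) else 0))"
      by (intro sum.cong) (auto simp: rr algebra_simps)
    also have "\<dots> = (if c = a then g b else 0) - (if c = b then g a else 0)"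
      using kg[of a a] by (simp add: sum_subtractf kg)
    finally show ?thesis by (simp add: flat_w inner_diff_left inner_sum_left ur)
  qed
  have ww: "flatten (w c) \<bullet> flatten (w c) = 1 - (\<Sum>b\<in>UNIV - {c}. (g b)\<^sup>2 / (s b + s c))" for c
  proof -
    \<comment> \<open>As \<open>w c\<close> is orthogonal to the subtracted rotations, one factor
      may be replaced by \<open>u c\<close>. The term for \<open>b = c\<close> then cancels because
      \<open>r c c\<close> is zero.\<close>
    have "flatten (w c) \<bullet> flatten (w c) = flatten (w c) \<bullet> flatten (u c)"
      by (subst (2) flat_w) (simp add: inner_diff_right inner_sum_right wr)
    also have "\<dots> = 1 - (\<Sum>b\<in>UNIV. k c b * (g b - (if c = b then g c else 0)))"
      by (simp add: flat_w inner_diff_left inner_sum_left uu ru)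
    also have "(\<Sum>b\<in>UNIV. k c b * (g b - (if c = b then g c else 0))) = (\<Sum>b\<in>UNIV - {c}. (g b)\<^sup>2 / (s b + s c))"
      by (subst sum.remove[of _ c]) (auto simp: k_def power2_eq_square intro!: sum.cong)
    finally show ?thesis .
  qed
  have sum_ww: "1 \<le> (\<Sum>c\<in>UNIV. flatten (w c) \<bullet> flatten (w c))"
  proof -
    \<comment> \<open>After dropping \<open>s c\<close> from the denominator, each axis
      \<open>b\<close> is counted for the \<open>CARD('d) - 1\<close> other axes \<open>c\<close>,
      and Bessel bounds the sum over \<open>b\<close> by 1.\<close>
    have "(\<Sum>c\<in>UNIV. \<Sum>b\<in>UNIV - {c}. (g b)\<^sup>2 / (s b + s c)) \<le> (\<Sum>c\<in>UNIV. \<Sum>b\<in>UNIV - {c}. (g b)\<^sup>2 / s b)"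
    proof (intro sum_mono)
      fix c b
      show "(g b)\<^sup>2 / (s b + s c) \<le> (g b)\<^sup>2 / s b"
        using g0[of b] s_nonneg[of b] s_nonneg[of c] by (cases "s b = 0") (auto intro!: divide_left_mono)
    qed
    also have "\<dots> = (\<Sum>c\<in>(UNIV::'d set). (\<Sum>b\<in>UNIV. (g b)\<^sup>2 / s b) - (g c)\<^sup>2 / s c)"
      by (intro sum.cong refl) (simp add: sum_diff1)
    also have "\<dots> = (real CARD('d) - 1) * (\<Sum>b\<in>UNIV. (g b)\<^sup>2 / s b)"
      by (simp add: sum_subtractf algebra_simps)
    also have "\<dots> \<le> (real CARD('d) - 1) * 1"
      using bessel_sum[OF yy, of f] f1 by (intro mult_left_mono) (auto simp: g_def Suc_leI)
    finally show ?thesis by (simp add: ww sum_subtractf)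
  qed

  have diff: "q v - q v' = p v - p v'" for v v' by (simp add: q_def)
  have "elongation p (t c) x = 0" for c x by (simp add: elongation_def t_def split: prod.split)
  then have Lt: "stiffness_matrix E p *v flatten (t c) = 0" for c
    by (rule stiffness_matrix_kernel[OF E])
  have "elongation p (r a b) x = 0" for a b and x :: "'v set"
  proof -
    obtain i j where ij: "edge_ends x = (i, j)" by fastforce
    have "r a b i - r a b j = ((p i - p j) \<bullet> e b) *\<^sub>R e a - ((p i - p j) \<bullet> e a) *\<^sub>R e b"
      by (simp add: r_def y_def diff[symmetric] inner_diff_left algebra_simps)
    then show ?thesis by (simp add: elongation_def ij edge_direction_rotation)
  qed
  then have Lr: "stiffness_matrix E p *v flatten (r a b) = 0" for a b
    by (rule stiffness_matrix_kernel[OF E])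
  \<comment> \<open>\<open>w c\<close> and \<open>u c\<close> differ by rotations, which lie in the
    kernel, so their energies agree.\<close>
  have Lw: "stiffness_matrix E p *v flatten (w c) = stiffness_matrix E p *v flatten (u c)" for c
    by (simp add: flat_w matrix_vector_mult_diff_distrib linear_sum[OF matrix_vector_mul_linear]
        matrix_vector_mult_scaleR Lr)
  define En where "En c = flatten (w c) \<bullet> (stiffness_matrix E p *v flatten (w c))" for c
  have En: "En c = (\<Sum>x\<in>E. (elongation p (u c) x)\<^sup>2)" for c
    unfolding stiffness_matrix_energy[OF E, symmetric] En_def
    by (metis Lw symmetric_dot_comm transpose_stiffness_matrix)
  have sum_En: "(\<Sum>c\<in>UNIV. En c) \<le> \<alpha>"
  proof -
    have "(\<Sum>c\<in>UNIV. En c) = (\<Sum>x\<in>E. \<Sum>c\<in>UNIV. (elongation p (u c) x)\<^sup>2)"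
      unfolding En by (rule sum.swap)
    also have "\<dots> \<le> (\<Sum>x\<in>E. (f (fst (edge_ends x)) - f (snd (edge_ends x)))\<^sup>2)"
    proof (intro sum_mono)
      fix x :: "'v set"
      obtain i j where ij: "edge_ends x = (i, j)" by fastforce
      let ?d = "edge_direction p i j"
      \<comment> \<open>Parseval over the axes turns the sum into the squared norm of the edge
        direction, which is at most 1.\<close>
      have "(\<Sum>c\<in>UNIV. (elongation p (u c) x)\<^sup>2) = (f i - f j)\<^sup>2 * (\<Sum>c\<in>UNIV. (?d \<bullet> e c)\<^sup>2)"
        by (simp add: elongation_def ij u_def scaleR_left_diff_distrib[symmetric] power_mult_distrib
            sum_distrib_left)
      also have "\<dots> = (f i - f j)\<^sup>2 * (norm ?d)\<^sup>2"
        by (simp add: orthonormal_family_expansion(2)[OF e, symmetric] power2_norm_eq_inner)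
      also have "\<dots> \<le> (f i - f j)\<^sup>2 * 1"
        by (intro mult_left_mono) (auto simp: norm_edge_direction_le power_le_one)
      finally show "(\<Sum>c\<in>UNIV. (elongation p (u c) x)\<^sup>2) \<le> (f (fst (edge_ends x)) - f (snd (edge_ends x)))\<^sup>2"
        by (simp add: ij)
    qed
    also note energy
    finally show ?thesis .
  qed
  have "0 \<le> \<alpha>" by (rule order_trans[OF _ energy]) (simp add: sum_nonneg)

  \<comment> \<open>Averaging: if every nonzero \<open>w c\<close> had Rayleigh quotient above
    \<alpha>, the total energy would exceed \<alpha>, because the squared norms sum to at least
    1.\<close>
  obtain c where w0: "flatten (w c) \<noteq> 0" and wle: "En c \<le> \<alpha> * (flatten (w c) \<bullet> flatten (w c))"
  proof (rule ccontr)
    assume "\<not> thesis"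
    with that have less: "\<alpha> * (flatten (w c) \<bullet> flatten (w c)) < En c" if "flatten (w c) \<noteq> 0" for c
      using \<open>flatten (w c) \<noteq> 0\<close> by force
    have le: "\<alpha> * (flatten (w c) \<bullet> flatten (w c)) \<le> En c" for c
      using less[of c] by (cases "flatten (w c) = 0") (auto simp: En_def)
    have "\<exists>c. flatten (w c) \<noteq> 0"
      using sum_ww by (rule contrapos_pp) simp
    then have "(\<Sum>c\<in>UNIV. \<alpha> * (flatten (w c) \<bullet> flatten (w c))) < (\<Sum>c\<in>UNIV. En c)"
      using le less by (intro sum_strict_mono_ex1) auto
    also note sum_En
    finally have "\<alpha> * (\<Sum>c\<in>UNIV. flatten (w c) \<bullet> flatten (w c)) < \<alpha>" by (simp add: sum_distrib_left)
    moreover have "\<alpha> * 1 \<le> \<alpha> * (\<Sum>c\<in>UNIV. flatten (w c) \<bullet> flatten (w c))"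
      using sum_ww \<open>0 \<le> \<alpha>\<close> by (rule mult_left_mono)
    ultimately show False by simp
  qed

  \<comment> \<open>An arbitrary linear order on the axes selects one of the opposite rotations
    \<open>r a b\<close> and \<open>r b a\<close>.\<close>
  obtain h :: "'d \<Rightarrow> nat" where h: "inj h" using finite_imp_inj_to_nat_seg[of "UNIV::'d set"] by auto
  define I where "I = {(a, b). h a \<le> h b \<and> (a = b \<or> a \<in> P \<or> b \<in> P)}"
  define z where "z = (\<lambda>(a, b). flatten (if a = b then t a else r a b))"
  have "trivial_motions_dim p = card I"
    using card_trivial_motions[OF h, of P] by (simp add: trivial_motions_dim_def dim I_def Let_def)
  moreover have "kth_eigenvalue (card I + 1) (stiffness_matrix E p) \<le> \<alpha>"
  proof (rule kth_eigenvalue_kernel_le[OF transpose_stiffness_matrix])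
    fix i j assume ij: "i \<in> I" "j \<in> I" "i \<noteq> j"
    obtain a b a' b' where ab: "i = (a, b)" "j = (a', b')" by (metis surj_pair)
    have "\<not> (a = b' \<and> b = a' \<and> a \<noteq> b)"
    proof
      assume "a = b' \<and> b = a' \<and> a \<noteq> b"
      then have "h a = h b" using ij ab by (auto simp: I_def)
      then show False using \<open>a = b' \<and> b = a' \<and> a \<noteq> b\<close> h by (metis injD)
    qed
    then show "z i \<bullet> z j = 0"
      using ij(3) by (auto simp: ab z_def tt tr rt rr)
  next
    fix i assume "i \<in> I"
    obtain a b where ab: "i = (a, b)" by (metis surj_pair)
    \<comment> \<open>A selected rotation involves an axis of positive moment, hence is
      nonzero.\<close>
    have "s a + s b \<noteq> 0" if "a \<noteq> b"
      using \<open>i \<in> I\<close> that s_nonneg[of a] s_nonneg[of b] by (auto simp: ab I_def P_def add_nonneg_eq_0_iff)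
    then have "z i \<bullet> z i \<noteq> 0" by (auto simp: ab z_def tt rr simp del: inner_eq_zero_iff)
    then show "z i \<noteq> 0" by auto
  qed (use w0 wle \<open>0 \<le> \<alpha>\<close> in \<open>auto simp: z_def Lt Lr wt wr En_def split: if_splits\<close>)
  ultimately show ?thesis by simp
qed

section \<open>Dimension one and the comparison\<close>

lemma line_realization_dims:
  fixes p :: "'v::finite \<Rightarrow> real^1"
  assumes "p i \<noteq> p j"
  shows "realization_dim p = 1" and "trivial_motions_dim p = 1"
proof -
  have "aff_dim (range p) \<le> 1" using aff_dim_le_DIM[of "range p"] by simp
  moreover have "aff_dim {p i, p j} \<le> aff_dim (range p)" by (intro aff_dim_subset) auto
  then have "1 \<le> aff_dim (range p)" using assms by (simp add: aff_dim_2)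
  ultimately show "realization_dim p = 1" by (simp add: realization_dim_def)
  then show "trivial_motions_dim p = 1" by (simp add: trivial_motions_dim_def)
qed

text \<open>On a line the unit direction is a sign, which squaring removes; the stiffness energy is
  thus that of the graph Laplacian.\<close>

lemma elongation_line:
  fixes p q :: "'v::finite \<Rightarrow> real^1"
  assumes "simple_graph E" "inj p" "e \<in> E"
  shows "(elongation p q e)\<^sup>2 = (q (fst (edge_ends e)) $ 1 - q (snd (edge_ends e)) $ 1)\<^sup>2"
proof -
  obtain i j where ij: "edge_ends e = (i, j)" by fastforce
  then have "p i \<noteq> p j" using edge_ends[OF assms(1,3)] assms(2) by (auto simp: inj_def)
  then have "p i $ 1 - p j $ 1 \<noteq> 0" by (simp add: vec_eq_iff)
  then show ?thesis using \<open>p i \<noteq> p j\<close>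
    by (simp add: elongation_def ij edge_direction_def inner_vec_def norm_vec_def L2_set_def
        power_mult_distrib power_divide divide_simps)
qed

text \<open>A two-dimensional space with Rayleigh quotients at most the second eigenvalue meets the
  hyperplane orthogonal to the constants; a normalized common vector is the function sought.\<close>

lemma fiedler_function_exists:
  fixes E :: "'v::finite set set" and p :: "'v \<Rightarrow> real^1"
  assumes E: "simple_graph E" and "CARD('v) \<ge> 2" and p: "inj p"
  obtains f where "(\<Sum>v\<in>UNIV. f v) = 0" "(\<Sum>v\<in>UNIV. (f v)\<^sup>2) = 1"
    "(\<Sum>e\<in>E. (f (fst (edge_ends e)) - f (snd (edge_ends e)))\<^sup>2) \<le> kth_eigenvalue 2 (stiffness_matrix E p)"
proof -
  let ?\<alpha> = "kth_eigenvalue 2 (stiffness_matrix E p)"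
  have "2 \<le> CARD('v \<times> 1)" using assms(2) by simp
  then obtain S where S: "subspace S" "2 \<le> dim S"
    and le: "\<And>x. x \<in> S \<Longrightarrow> x \<bullet> (stiffness_matrix E p *v x) \<le> ?\<alpha> * (x \<bullet> x)"
    using kth_eigenvalue_subspace[OF transpose_stiffness_matrix, of 2 E p] by auto
  let ?o = "flatten (\<lambda>v::'v. 1 :: real^1)"
  have "?o \<noteq> 0" by (simp add: flatten_eq_0_iff fun_eq_iff)
  then have "dim {x. ?o \<bullet> x = 0} = DIM(real^('v \<times> 1)) - 1" by (rule dim_hyperplane)
  then have "DIM(real^('v \<times> 1)) < dim S + dim {x. ?o \<bullet> x = 0}" using S(2) assms(2) by simp
  then obtain x where x: "x \<in> S" "?o \<bullet> x = 0" "x \<noteq> 0"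
    using subspaces_intersect[OF S(1) subspace_hyperplane] by blast
  define f where "f v = x $ (v, 1) / norm x" for v
  define q :: "'v \<Rightarrow> real^1" where "q v = vec (f v)" for v
  have "x /\<^sub>R norm x = flatten q"
    by (auto simp: vec_eq_iff flatten_def q_def f_def divide_inverse mult.commute)
  then have qS: "flatten q \<in> S" and q0: "?o \<bullet> flatten q = 0" and q1: "norm (flatten q) = 1"
    using x S(1) by (metis subspace_scale, metis inner_scaleR_right mult_zero_right, metis norm_sgn sgn_div_norm)
  have qq: "flatten q \<bullet> flatten q = 1" using q1 by (simp add: norm_eq_1)
  show ?thesis
  proof (rule that[of f])
    show "(\<Sum>v\<in>UNIV. f v) = 0" using q0 unfolding inner_flatten by (simp add: q_def inner_vec_def)
    show "(\<Sum>v\<in>UNIV. (f v)\<^sup>2) = 1" using qq unfolding inner_flatten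
      by (simp add: q_def inner_vec_def power2_eq_square)
    have "(\<Sum>e\<in>E. (f (fst (edge_ends e)) - f (snd (edge_ends e)))\<^sup>2) = (\<Sum>e\<in>E. (elongation p q e)\<^sup>2)"
      by (intro sum.cong) (auto simp: elongation_line[OF E p] q_def)
    also have "\<dots> \<le> ?\<alpha>" using le[OF qS] by (simp add: stiffness_matrix_energy[OF E] qq)
    finally show "(\<Sum>e\<in>E. (f (fst (edge_ends e)) - f (snd (edge_ends e)))\<^sup>2) \<le> ?\<alpha>" .
  qed
qed

theorem theorem1:
  fixes E :: "'v::finite set set"
  assumes "simple_graph E"
    and "CARD('v) \<ge> 2"
  shows "algebraic_connectivity TYPE('d::finite) E \<le> algebraic_connectivity TYPE(1) E"
proof -
  obtain h :: "'v \<Rightarrow> nat" where h: "inj h" using finite_imp_inj_to_nat_seg[of "UNIV::'v set"] by auto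
  \<comment> \<open>Distinct points on a line, so that the stiffness energy is the Laplacian energy
    and \<open>?\<alpha>\<close> the second Laplacian eigenvalue.\<close>
  define p :: "'v \<Rightarrow> real^1" where "p v = vec (real (h v))" for v
  have p: "inj p" using h by (auto simp: inj_def p_def vec_eq_iff)
  let ?\<alpha> = "kth_eigenvalue 2 (stiffness_matrix E p)"
  obtain f where f: "(\<Sum>v\<in>UNIV. f v) = 0" "(\<Sum>v\<in>UNIV. (f v)\<^sup>2) = 1"
    "(\<Sum>e\<in>E. (f (fst (edge_ends e)) - f (snd (edge_ends e)))\<^sup>2) \<le> ?\<alpha>"
    using fiedler_function_exists[OF assms p] by blast
  note le = kth_eigenvalue_stiffness_le[OF assms(1) f]
  obtain i j :: 'v where "i \<noteq> j" using assms(2) by (metis card_2_iff' ex_card finite subset_UNIV)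
  then have "p i \<noteq> p j" using p by (auto simp: inj_def)
  from line_realization_dims(2)[of p, OF this] have dim1: "trivial_motions_dim p + 1 = 2" by simp
  have "algebraic_connectivity TYPE('d) E \<le> ?\<alpha>"
    unfolding algebraic_connectivity_def by (intro cSUP_least le) simp
  also have "?\<alpha> \<le> algebraic_connectivity TYPE(1) E"
  proof -
    \<comment> \<open>A real supremum dominates its members only if the set is bounded above; the
      uniform bound, now in dimension one, provides this.\<close>
    have "bdd_above (range (\<lambda>p :: 'v \<Rightarrow> real^1.
        kth_eigenvalue (trivial_motions_dim p + 1) (stiffness_matrix E p)))"
      by (rule bdd_aboveI2) (rule le)
    from cSUP_upper[OF UNIV_I this, of p] show ?thesis
      unfolding algebraic_connectivity_def dim1 .
  qed
  finally show ?thesis .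
qed

end
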